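(* Let $\mathbf P=(P,\leq,*,1)$ be a strongly sectionally pseudocomplemented poset, $n\geq1$, $a,a_1,\ldots,a_n,b\in P$ and $\Theta\in\operatorname{Con}\mathbf P$. Then the following hold: (i) if $a\leq b$ then $[a]\Theta\leq'[b]\Theta$; (ii) $[a]\Theta\leq'[b]\Theta$ if and only if there exists some $c\in[b]\Theta$ with $a\leq c$; (iii) $(P/\Theta,\leq')$ is a poset; (iv) every class of $\Theta$ is up-directed (with respect to the order induced by $\leq$); (v) $U([a_1]\Theta,\ldots,[a_n]\Theta)=\{[x]\Theta\mid x\in U(a_1,\ldots,a_n)\}$, where the left-hand side is taken in $(P/\Theta,\leq')$.
   Context: For a poset $(P,\leq)$ and $A\subseteq P$, $U(A)$ and $L(A)$ denote the sets of all upper, respectively lower, bounds of $A$; $U(a_1,\ldots,a_n)=U(\{a_1,\ldots,a_n\})$, $L(b)=L(\{b\})$, $L(U(a,b),c)=L(U(a,b)\cup\{c\})$. The poset is sectionally pseudocomplemented if for all $a,b\in P$ there exists a greatest element $c$ of $P$ with $L(U(a,b),c)=L(b)$; this $c$ is denoted by $a*b$, and one writes $(P,\leq,* )$. A strongly sectionally pseudocomplemented poset is a quadruple $(P,\leq,*,1)$ such that $(P,\leq,* )$ is a sectionally pseudocomplemented poset with greatest element $1$ satisfying $x\leq(x*y)*y$ for all $x,y\in P$. A binary relation $\rho$ on $P$ is $\min$-stable if whenever $(a,b),(c,d)\in\rho$, $a$ is comparable with $c$ and $b$ is comparable with $d$, then $(\min(a,c),\min(b,d))\in\rho$. A congruence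 on $\mathbf P$ is a $\min$-stable congruence on the algebra $(P,*,1)$; $\operatorname{Con}\mathbf P$ is the set of all of them. On $P/\Theta$ the operation is $[a]\Theta*[b]\Theta=[a*b]\Theta$, and the binary relation $\leq'$ on $P/\Theta$ is defined by: $[a]\Theta\leq'[b]\Theta$ if and only if $[a]\Theta*[b]\Theta=[1]\Theta$. A poset is up-directed if any two of its elements have a common upper bound in it. *)

theory Defs
  imports Main
begin

text \<open>
  A poset is a carrier \<open>P\<close> with a relation \<open>le\<close> such that \<open>partial_order_on P le\<close>. Then
  \<open>Field le = P\<close>, so the library's \<open>Above le A\<close> and \<open>Under le A\<close> are the sets \<open>U(A)\<close> and \<open>L(A)\<close>
  of upper and lower bounds of \<open>A\<close> in \<open>P\<close>.
\<close>

lemma partial_order_on_Field: "partial_order_on P le \<Longrightarrow> Field le = P"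
  by (auto simp: partial_order_on_def preorder_on_def refl_on_def Field_def)

definition is_greatest :: "'a rel \<Rightarrow> 'a set \<Rightarrow> 'a \<Rightarrow> bool" where
  "is_greatest le A g \<longleftrightarrow> g \<in> A \<and> (\<forall>x\<in>A. (x, g) \<in> le)"

text \<open>\<open>star a b\<close> is the sectional pseudocomplement \<open>a * b\<close>; it is unconstrained outside \<open>P\<close>.\<close>

locale sectionally_pc_poset =
  fixes P :: "'a set" and le :: "'a rel" and star :: "'a \<Rightarrow> 'a \<Rightarrow> 'a"
  assumes partial_order: "partial_order_on P le"
    and star_greatest: "\<And>a b. a \<in> P \<Longrightarrow> b \<in> P \<Longrightarrow>
      is_greatest le {c \<in> P. Under le (Above le {a, b} \<union> {c}) = Under le {b}} (star a b)"

locale strongly_sectionally_pc_poset = sectionally_pc_poset +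
  fixes one :: 'a
  assumes one_greatest: "is_greatest le P one"
    and strong: "\<And>x y. x \<in> P \<Longrightarrow> y \<in> P \<Longrightarrow> (x, star (star x y) y) \<in> le"

definition comparable :: "'a rel \<Rightarrow> 'a \<Rightarrow> 'a \<Rightarrow> bool" where
  "comparable le a b \<longleftrightarrow> (a, b) \<in> le \<or> (b, a) \<in> le"

text \<open>The minimum of two comparable elements.\<close>

definition min_of :: "'a rel \<Rightarrow> 'a \<Rightarrow> 'a \<Rightarrow> 'a" where
  "min_of le a b = (if (a, b) \<in> le then a else b)"

definition min_stable :: "'a rel \<Rightarrow> 'a rel \<Rightarrow> bool" where
  "min_stable le \<rho> \<longleftrightarrow> (\<forall>a b c d. (a, b) \<in> \<rho> \<and> (c, d) \<in> \<rho> \<and> comparable le a c \<and> comparable le b d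
     \<longrightarrow> (min_of le a c, min_of le b d) \<in> \<rho>)"

text \<open>Compatibility with the constant \<open>1\<close> is automatic from reflexivity.\<close>

definition algebra_congruence :: "'a set \<Rightarrow> ('a \<Rightarrow> 'a \<Rightarrow> 'a) \<Rightarrow> 'a rel \<Rightarrow> bool" where
  "algebra_congruence P star \<Theta> \<longleftrightarrow> equiv P \<Theta> \<and>
     (\<forall>a b c d. (a, b) \<in> \<Theta> \<and> (c, d) \<in> \<Theta> \<longrightarrow> (star a c, star b d) \<in> \<Theta>)"

definition Con :: "'a set \<Rightarrow> 'a rel \<Rightarrow> ('a \<Rightarrow> 'a \<Rightarrow> 'a) \<Rightarrow> 'a rel set" where
  "Con P le star = {\<Theta>. algebra_congruence P star \<Theta> \<and> min_stable le \<Theta>}"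

text \<open>
  The operation \<open>[a] * [b] = [a * b]\<close> on \<open>P // \<Theta>\<close>, written as a union over all choices of
  representatives; the defining equation is the lemma below.
\<close>

definition quot_star :: "'a rel \<Rightarrow> ('a \<Rightarrow> 'a \<Rightarrow> 'a) \<Rightarrow> 'a set \<Rightarrow> 'a set \<Rightarrow> 'a set" where
  "quot_star \<Theta> star A B = (\<Union>x\<in>A. \<Union>y\<in>B. \<Theta> `` {star x y})"

lemma quot_star_class:
  assumes "algebra_congruence P star \<Theta>" "a \<in> P" "b \<in> P"
  shows "quot_star \<Theta> star (\<Theta> `` {a}) (\<Theta> `` {b}) = \<Theta> `` {star a b}"
proof -
  have eq: "equiv P \<Theta>"
    using assms(1) by (simp add: algebra_congruence_def)
  have "congruent2 \<Theta> \<Theta> (\<lambda>x y. \<Theta> `` {star x y})"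
  proof (rule congruent2I')
    fix y1 z1 y2 z2 assume "(y1, z1) \<in> \<Theta>" "(y2, z2) \<in> \<Theta>"
    then have "(star y1 y2, star z1 z2) \<in> \<Theta>"
      using assms(1) unfolding algebra_congruence_def by blast
    then show "\<Theta> `` {star y1 y2} = \<Theta> `` {star z1 z2}"
      by (rule equiv_class_eq[OF eq])
  qed
  from UN_equiv_class2[OF eq eq this assms(2,3)] show ?thesis
    unfolding quot_star_def .
qed

definition quot_le :: "'a set \<Rightarrow> ('a \<Rightarrow> 'a \<Rightarrow> 'a) \<Rightarrow> 'a \<Rightarrow> 'a rel \<Rightarrow> 'a set rel" where
  "quot_le P star one \<Theta> =
     {(A, B). A \<in> P // \<Theta> \<and> B \<in> P // \<Theta> \<and> quot_star \<Theta> star A B = \<Theta> `` {one}}"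

definition up_directed :: "'a set \<Rightarrow> 'a rel \<Rightarrow> bool" where
  "up_directed A r \<longleftrightarrow> (\<forall>x\<in>A. \<forall>y\<in>A. \<exists>z\<in>A. (x, z) \<in> r \<and> (y, z) \<in> r)"

end

theory Submission
  imports Defs
begin

text \<open>
  In a sectionally pseudocomplemented poset \<open>1 * b = b\<close>, and \<open>a * b = 1\<close> iff \<open>a \<le> b\<close>. Hence, if
  \<open>a * b\<close> is congruent to \<open>1\<close>, then \<open>(a * b) * b\<close> is congruent to \<open>b\<close>, and by strongness it lies
  above \<open>a\<close>; it also lies above \<open>b\<close>. This single element witnesses (ii) and, for congruent \<open>a\<close>
  and \<open>b\<close>, the directedness of classes, from which (v) follows since finite subsets of a class have
  upper bounds in it. Min-stability makes the classes convex, which gives antisymmetry of the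
  quotient order.
\<close>

text \<open>Induction on \<open>B\<close>: directedness supplies an element above both the new
  member and the bound found so far. Nonemptiness of \<open>A\<close> covers
  \<open>B = {}\<close>.\<close>

lemma up_directed_finite_upper_bound:
  assumes "up_directed A r" "trans r" "A \<noteq> {}" "finite B" "B \<subseteq> A"
  shows "\<exists>z\<in>A. \<forall>x\<in>B. (x, z) \<in> r"
  using assms(4,5)
proof (induction B rule: finite_induct)
  case empty
  then show ?case using assms(3) by blast
next
  case (insert x B)
  then obtain y where y: "y \<in> A" "\<forall>x\<in>B. (x, y) \<in> r"
    by blast
  moreover obtain z where "z \<in> A" "(x, z) \<in> r" "(y, z) \<in> r"
    using assms(1) y(1) insert.prems unfolding up_directed_def by blast
  ultimately show ?case
    using assms(2) by (blast dest: transD)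
qed

section \<open>Bounds and the sectional pseudocomplement\<close>

context sectionally_pc_poset
begin

lemma le_refl: "x \<in> P \<Longrightarrow> (x, x) \<in> le"
  using partial_order by (auto simp: partial_order_on_def preorder_on_def refl_on_def)

lemma trans_le: "trans le"
  using partial_order by (simp add: partial_order_on_def preorder_on_def)

lemma le_trans: "(x, y) \<in> le \<Longrightarrow> (y, z) \<in> le \<Longrightarrow> (x, z) \<in> le"
  using trans_le by (rule transD)

lemma antisym_le: "antisym le"
  using partial_order by (simp add: partial_order_on_def)

lemma le_closed: "(x, y) \<in> le \<Longrightarrow> x \<in> P \<and> y \<in> P"
  using partial_order_on_Field[OF partial_order] by (auto simp: Field_def)

lemma Above_iff: "y \<in> Above le A \<longleftrightarrow> y \<in> P \<and> (\<forall>x\<in>A. (x, y) \<in> le)"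
  by (simp add: Above_def partial_order_on_Field[OF partial_order])

lemma Under_iff: "x \<in> Under le A \<longleftrightarrow> x \<in> P \<and> (\<forall>y\<in>A. (x, y) \<in> le)"
  by (simp add: Under_def partial_order_on_Field[OF partial_order])

lemma star_closed: "a \<in> P \<Longrightarrow> b \<in> P \<Longrightarrow> star a b \<in> P"
  using star_greatest[of a b] by (simp add: is_greatest_def)

lemma Under_Above_star:
  "a \<in> P \<Longrightarrow> b \<in> P \<Longrightarrow> Under le (Above le {a, b} \<union> {star a b}) = Under le {b}"
  using star_greatest[of a b] by (simp add: is_greatest_def)

lemma le_star_if:
  "a \<in> P \<Longrightarrow> b \<in> P \<Longrightarrow> c \<in> P \<Longrightarrow> Under le (Above le {a, b} \<union> {c}) = Under le {b} \<Longrightarrow>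
    (c, star a b) \<in> le"
  using star_greatest[of a b] by (simp add: is_greatest_def)

text \<open>The defining equation \<open>L(U(a,b), a * b) = L(b)\<close> has \<open>b\<close> on its
  right-hand side, hence also on its left, which puts \<open>b\<close> below
  \<open>a * b\<close>.\<close>

lemma le_star:
  assumes "a \<in> P" "b \<in> P"
  shows "(b, star a b) \<in> le"
proof -
  have "b \<in> Under le {b}"
    using assms by (simp add: Under_iff le_refl)
  then have "b \<in> Under le (Above le {a, b} \<union> {star a b})"
    using Under_Above_star[OF assms] by (simp only:)
  then show ?thesis
    by (simp add: Under_iff)
qed

end

section \<open>The greatest element and the pseudocomplement\<close>

context strongly_sectionally_pc_poset
begin

lemma one_closed: "one \<in> P"
  and le_one: "x \<in> P \<Longrightarrow> (x, one) \<in> le"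
  using one_greatest by (simp_all add: is_greatest_def)

text \<open>If \<open>a * b = 1\<close>, then \<open>a\<close>, lying in
  \<open>L(U(a,b), 1)\<close>, lies in \<open>L(b)\<close>. If \<open>a \<le> b\<close>, then
  \<open>b\<close> is the least member of \<open>U(a,b)\<close>, so 1 satisfies the defining
  equation and \<open>a * b\<close>, being the greatest solution, equals 1.\<close>

lemma star_eq_one_iff:
  assumes "a \<in> P" "b \<in> P"
  shows "star a b = one \<longleftrightarrow> (a, b) \<in> le"
proof
  assume "star a b = one"
  moreover have "a \<in> Under le (Above le {a, b} \<union> {one})"
    using assms by (simp add: Under_iff Above_iff le_one)
  ultimately have "a \<in> Under le {b}"
    using Under_Above_star[OF assms] by simp
  then show "(a, b) \<in> le"
    by (simp add: Under_iff)
next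
  assume ab: "(a, b) \<in> le"
  have "Under le (Above le {a, b} \<union> {one}) = Under le {b}"
  proof (intro equalityI subsetI)
    fix x assume "x \<in> Under le (Above le {a, b} \<union> {one})"
    moreover have "b \<in> Above le {a, b}"
      using ab assms le_refl by (simp add: Above_iff)
    ultimately show "x \<in> Under le {b}"
      by (simp add: Under_iff)
  next
    fix x assume "x \<in> Under le {b}"
    then show "x \<in> Under le (Above le {a, b} \<union> {one})"
      using le_one by (auto simp: Under_iff Above_iff intro: le_trans[of x b])
  qed
  then have "(one, star a b) \<in> le"
    using assms one_closed by (rule le_star_if[rotated 3])
  then show "star a b = one"
    using antisymD[OF antisym_le] le_one star_closed[OF assms] by blast
qed

text \<open>As 1 is the only element of \<open>U(1,b)\<close>, the defining equation collapses to
  \<open>L(1 * b) = L(b)\<close>.\<close>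

lemma one_star:
  assumes "b \<in> P"
  shows "star one b = b"
proof -
  have "star one b \<in> Under le (Above le {one, b} \<union> {star one b})"
    using star_closed[OF one_closed assms]
    by (auto simp: Under_iff Above_iff le_refl intro: le_one le_trans[of _ one])
  then have "star one b \<in> Under le {b}"
    using Under_Above_star[OF one_closed assms] by (simp only:)
  then have "(star one b, b) \<in> le"
    by (simp add: Under_iff)
  then show ?thesis
    using antisymD[OF antisym_le] le_star[OF one_closed assms] by blast
qed

end

section \<open>Congruences and convexity of their classes\<close>

locale spc_congruence = strongly_sectionally_pc_poset +
  fixes \<Theta> :: "'a rel"
  assumes congruence: "\<Theta> \<in> Con P le star"
begin

lemma algebra_cong: "algebra_congruence P star \<Theta>"
  using congruence by (simp add: Con_def)

lemma equiv_P: "equiv P \<Theta>"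
  using algebra_cong by (simp add: algebra_congruence_def)

lemma cong_closed: "(x, y) \<in> \<Theta> \<Longrightarrow> x \<in> P \<and> y \<in> P"
  using equiv_class_eq_iff[OF equiv_P] by blast

lemma cong_refl: "x \<in> P \<Longrightarrow> (x, x) \<in> \<Theta>"
  using equiv_class_eq_iff[OF equiv_P] by blast

lemma cong_sym: "(x, y) \<in> \<Theta> \<Longrightarrow> (y, x) \<in> \<Theta>"
  using equiv_P by (blast elim: equivE dest: symD)

lemma star_cong: "(a, b) \<in> \<Theta> \<Longrightarrow> (c, d) \<in> \<Theta> \<Longrightarrow> (star a c, star b d) \<in> \<Theta>"
  using algebra_cong unfolding algebra_congruence_def by blast

text \<open>Min-stability applied to the pairs \<open>(x, z)\<close> and \<open>(y, y)\<close>: the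
  minimum of \<open>x\<close> and \<open>y\<close> is \<open>x\<close>, that of \<open>z\<close> and
  \<open>y\<close> is \<open>y\<close>.\<close>

lemma cong_convex:
  assumes "(x, z) \<in> \<Theta>" "(x, y) \<in> le" "(y, z) \<in> le"
  shows "(x, y) \<in> \<Theta>"
proof -
  have "(y, y) \<in> \<Theta>" "comparable le x y" "comparable le z y"
    using assms le_closed by (auto simp: comparable_def cong_refl)
  with assms(1) have "(min_of le x y, min_of le z y) \<in> \<Theta>"
    using congruence unfolding Con_def min_stable_def by blast
  \<comment> \<open>\<open>min_of\<close> returns \<open>z\<close> only if \<open>z \<le> y\<close>,
    and then antisymmetry gives \<open>z = y\<close>.\<close>
  moreover have "min_of le z y = y"
    using assms(3) antisymD[OF antisym_le] by (auto simp: min_of_def)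
  ultimately show ?thesis
    using assms(2) by (simp add: min_of_def)
qed

text \<open>Multiplying the given pair by \<open>b\<close> on the right makes
  \<open>star (star a b) b\<close> congruent to \<open>1 * b = b\<close>.\<close>

lemma star_star_cong:
  assumes "a \<in> P" "b \<in> P" "(star a b, one) \<in> \<Theta>"
  shows "(b, star (star a b) b) \<in> \<Theta>"
  using cong_sym[OF star_cong[OF assms(3) cong_refl[OF assms(2)]]] assms(2)
  by (simp add: one_star)

section \<open>The quotient order through representatives\<close>

lemma quot_le_class_iff_star:
  assumes "a \<in> P" "b \<in> P"
  shows "(\<Theta> `` {a}, \<Theta> `` {b}) \<in> quot_le P star one \<Theta> \<longleftrightarrow> (star a b, one) \<in> \<Theta>"
  using assms
  by (simp add: quot_le_def quotientI quot_star_class[OF algebra_cong] star_closed one_closed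
      eq_equiv_class_iff[OF equiv_P])

text \<open>Forwards, the witness is \<open>star (star a b) b\<close>, which lies above
  \<open>a\<close> by strongness. Backwards, \<open>a * c = 1\<close>, and replacing
  \<open>c\<close> by the congruent \<open>b\<close> makes \<open>a * b\<close> congruent to
  1.\<close>

lemma quot_le_class_iff:
  assumes "a \<in> P" "b \<in> P"
  shows "(\<Theta> `` {a}, \<Theta> `` {b}) \<in> quot_le P star one \<Theta> \<longleftrightarrow> (\<exists>c\<in>\<Theta> `` {b}. (a, c) \<in> le)"
proof
  assume "(\<Theta> `` {a}, \<Theta> `` {b}) \<in> quot_le P star one \<Theta>"
  then have "(b, star (star a b) b) \<in> \<Theta>"
    using assms by (simp add: quot_le_class_iff_star star_star_cong)
  then show "\<exists>c\<in>\<Theta> `` {b}. (a, c) \<in> le"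
    using strong[OF assms] by blast
next
  assume "\<exists>c\<in>\<Theta> `` {b}. (a, c) \<in> le"
  then obtain c where c: "(b, c) \<in> \<Theta>" "(a, c) \<in> le" by blast
  then have "star a c = one"
    using star_eq_one_iff le_closed by blast
  then show "(\<Theta> `` {a}, \<Theta> `` {b}) \<in> quot_le P star one \<Theta>"
    using star_cong[OF cong_refl[OF assms(1)] c(1)] assms by (simp add: quot_le_class_iff_star)
qed

lemma le_imp_quot_le: "(a, b) \<in> le \<Longrightarrow> (\<Theta> `` {a}, \<Theta> `` {b}) \<in> quot_le P star one \<Theta>"
  using quot_le_class_iff cong_refl le_closed by blast

lemma class_eq:
  assumes "A \<in> P // \<Theta>" "a \<in> A"
  shows "a \<in> P \<and> \<Theta> `` {a} = A"
proof -
  obtain x where "A = \<Theta> `` {x}"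
    using assms(1) by (rule quotientE)
  moreover have "(x, a) \<in> \<Theta>"
    using assms(2) calculation by simp
  ultimately show ?thesis
    using equiv_class_eq[OF equiv_P] cong_closed by blast
qed

text \<open>The representative \<open>a\<close> is arbitrary, so a chain of inequalities between
  classes can be followed upwards in \<open>P\<close>, each step starting where the last one
  ended.\<close>

lemma quot_le_obtain:
  assumes "(A, B) \<in> quot_le P star one \<Theta>" "a \<in> A"
  obtains b where "b \<in> B" "(a, b) \<in> le"
proof -
  have AB: "A \<in> P // \<Theta>" "B \<in> P // \<Theta>"
    using assms(1) by (simp_all add: quot_le_def)
  then obtain b where "b \<in> P" "B = \<Theta> `` {b}"
    by (blast elim: quotientE)
  moreover have "a \<in> P" "A = \<Theta> `` {a}"
    using class_eq[OF AB(1) assms(2)] by simp_all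
  ultimately show thesis
    using assms(1) that quot_le_class_iff[of a b] by blast
qed

lemma class_nonempty: "A \<in> P // \<Theta> \<Longrightarrow> A \<noteq> {}"
  using in_quotient_imp_non_empty[OF equiv_P] by blast

lemma quot_leI:
  assumes "A \<in> P // \<Theta>" "B \<in> P // \<Theta>" "a \<in> A" "b \<in> B" "(a, b) \<in> le"
  shows "(A, B) \<in> quot_le P star one \<Theta>"
  using le_imp_quot_le[OF assms(5)] class_eq[OF assms(1,3)] class_eq[OF assms(2,4)] by simp

lemma quot_le_in: "(A, B) \<in> quot_le P star one \<Theta> \<Longrightarrow> A \<in> P // \<Theta> \<and> B \<in> P // \<Theta>"
  by (simp add: quot_le_def)

lemma partial_order_quot_le: "partial_order_on (P // \<Theta>) (quot_le P star one \<Theta>)"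
proof -
  let ?r = "quot_le P star one \<Theta>"
  have "(A, A) \<in> ?r" if "A \<in> P // \<Theta>" for A
    using class_nonempty[OF that] quot_leI[OF that that] class_eq[OF that] le_refl by blast
  then have "refl_on (P // \<Theta>) ?r"
    using quot_le_in by (auto simp: refl_on_def)
  moreover have "trans ?r"
  proof (rule transI)
    fix A B C assume AB: "(A, B) \<in> ?r" and BC: "(B, C) \<in> ?r"
    obtain a where a: "a \<in> A"
      using class_nonempty quot_le_in[OF AB] by blast
    obtain b where b: "b \<in> B" "(a, b) \<in> le"
      using quot_le_obtain[OF AB a] .
    obtain c where c: "c \<in> C" "(b, c) \<in> le"
      using quot_le_obtain[OF BC b(1)] .
    show "(A, C) \<in> ?r"
      using quot_leI[of A C a c] quot_le_in AB BC a b c le_trans by blast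
  qed
  moreover have "antisym ?r"
  proof (rule antisymI)
    fix A B assume AB: "(A, B) \<in> ?r" and BA: "(B, A) \<in> ?r"
    obtain a where a: "a \<in> A"
      using class_nonempty quot_le_in[OF AB] by blast
    obtain b where b: "b \<in> B" "(a, b) \<in> le"
      using quot_le_obtain[OF AB a] .
    \<comment> \<open>Going up from \<open>A\<close> to \<open>B\<close> and back to
      \<open>A\<close> encloses \<open>b\<close> between two members of \<open>A\<close>, so
      convexity puts \<open>b\<close> into \<open>A\<close>.\<close>
    obtain a' where a': "a' \<in> A" "(b, a') \<in> le"
      using quot_le_obtain[OF BA b(1)] .
    have "(a, a') \<in> \<Theta>"
      using a a'(1) class_eq quot_le_in[OF AB] by blast
    then have "(a, b) \<in> \<Theta>"
      using cong_convex b(2) a'(2) by blast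
    then show "A = B"
      using equiv_class_eq[OF equiv_P, of a b] class_eq[of A a] class_eq[of B b] a b(1) quot_le_in[OF AB]
      by simp
  qed
  moreover have "?r \<subseteq> (P // \<Theta>) \<times> (P // \<Theta>)"
    using quot_le_in by auto
  ultimately show ?thesis
    by (simp add: partial_order_on_def preorder_on_def)
qed

lemma class_up_directed:
  assumes "C \<in> P // \<Theta>"
  shows "up_directed C (Restr le C)"
  unfolding up_directed_def
proof (intro ballI)
  fix x y assume xy: "x \<in> C" "y \<in> C"
  then have P: "x \<in> P" "y \<in> P" and C: "\<Theta> `` {y} = C"
    using class_eq[OF assms xy(1)] class_eq[OF assms xy(2)] by simp_all
  then have "(x, y) \<in> \<Theta>"
    using class_eq[OF assms xy(1)] xy(2) by blast
  \<comment> \<open>Multiply the congruent \<open>x\<close> and \<open>y\<close> by \<open>y\<close>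
    on the right and use \<open>y * y = 1\<close>.\<close>
  then have "(star x y, one) \<in> \<Theta>"
    using star_cong[OF _ cong_refl[OF P(2)], of x y] star_eq_one_iff[OF P(2,2)] le_refl[OF P(2)]
    by simp
  then have "star (star x y) y \<in> C"
    using star_star_cong[OF P] C by blast
  \<comment> \<open>The bound \<open>star (star x y) y\<close> is above \<open>x\<close> by
    strongness and above \<open>y\<close> because every pseudocomplement relative to
    \<open>y\<close> is.\<close>
  then show "\<exists>z\<in>C. (x, z) \<in> Restr le C \<and> (y, z) \<in> Restr le C"
    using xy strong[OF P] le_star[OF star_closed[OF P] P(2)] by blast
qed

text \<open>An upper bound \<open>B\<close> of the classes contains, for each \<open>a\<close> in
  \<open>A\<close>, some element above \<open>a\<close>. These are finitely many, so directedness of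
  \<open>B\<close> bounds them by a single \<open>z\<close> in \<open>B\<close>; then
  \<open>z\<close> is above all of \<open>A\<close> and represents \<open>B\<close>. The other
  inclusion is monotonicity of the passage to classes.\<close>

lemma Above_quot_le_image:
  assumes "finite A" "A \<subseteq> P"
  shows "Above (quot_le P star one \<Theta>) ((\<lambda>x. \<Theta> `` {x}) ` A) = (\<lambda>x. \<Theta> `` {x}) ` Above le A"
    (is "?L = ?R")
proof
  show "?L \<subseteq> ?R"
  proof
    fix B assume "B \<in> ?L"
    then have B: "B \<in> P // \<Theta>" and ub: "\<forall>a\<in>A. (\<Theta> `` {a}, B) \<in> quot_le P star one \<Theta>"
      by (simp_all add: Above_def partial_order_on_Field[OF partial_order_quot_le])
    have "\<forall>a\<in>A. \<exists>c\<in>B. (a, c) \<in> le"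
    proof
      fix a assume "a \<in> A"
      then have "a \<in> \<Theta> `` {a}"
        using assms(2) cong_refl by blast
      with ub \<open>a \<in> A\<close> show "\<exists>c\<in>B. (a, c) \<in> le"
        by (meson quot_le_obtain)
    qed
    then obtain c where c: "\<forall>a\<in>A. c a \<in> B \<and> (a, c a) \<in> le"
      by metis
    have "trans (Restr le B)"
      using trans_le by (rule trans_Restr)
    then obtain z where z: "z \<in> B" "\<forall>x\<in>c ` A. (x, z) \<in> Restr le B"
      using up_directed_finite_upper_bound[OF class_up_directed[OF B], of "c ` A"]
        class_nonempty[OF B] assms(1) c by blast
    then have "z \<in> Above le A"
      using c class_eq[OF B] le_trans unfolding Above_iff by blast
    then show "B \<in> ?R"
      using class_eq[OF B z(1)] by blast
  qed
  show "?R \<subseteq> ?L"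
  proof
    fix B assume "B \<in> ?R"
    then obtain x where x: "x \<in> P" "\<forall>a\<in>A. (a, x) \<in> le" "B = \<Theta> `` {x}"
      by (auto simp: Above_iff)
    then have "B \<in> P // \<Theta>" "\<forall>a\<in>A. (\<Theta> `` {a}, B) \<in> quot_le P star one \<Theta>"
      by (simp_all add: quotientI le_imp_quot_le)
    then show "B \<in> ?L"
      by (simp add: Above_def partial_order_on_Field[OF partial_order_quot_le])
  qed
qed

end

theorem theorem4p2:
  fixes P :: "'a set" and le :: "'a rel" and star :: "'a \<Rightarrow> 'a \<Rightarrow> 'a" and one :: 'a
    and n :: nat and a b :: 'a and as :: "nat \<Rightarrow> 'a" and \<Theta> :: "'a rel"
  assumes "strongly_sectionally_pc_poset P le star one"
    and "n \<ge> 1"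
    and "a \<in> P" and "\<And>i. i \<in> {1..n} \<Longrightarrow> as i \<in> P" and "b \<in> P"
    and "\<Theta> \<in> Con P le star"
  shows "((a, b) \<in> le \<longrightarrow> (\<Theta> `` {a}, \<Theta> `` {b}) \<in> quot_le P star one \<Theta>) \<and>
    ((\<Theta> `` {a}, \<Theta> `` {b}) \<in> quot_le P star one \<Theta> \<longleftrightarrow> (\<exists>c \<in> \<Theta> `` {b}. (a, c) \<in> le)) \<and>
    partial_order_on (P // \<Theta>) (quot_le P star one \<Theta>) \<and>
    (\<forall>C \<in> P // \<Theta>. up_directed C (Restr le C)) \<and>
    Above (quot_le P star one \<Theta>) ((\<lambda>i. \<Theta> `` {as i}) ` {1..n}) =
      {\<Theta> `` {x} | x. x \<in> Above le (as ` {1..n})}"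
proof -
  interpret spc_congruence P le star one \<Theta>
    using assms(1,6) by (simp add: spc_congruence_def spc_congruence_axioms_def)
  have "as ` {1..n} \<subseteq> P"
    using assms(4) by blast
  from Above_quot_le_image[OF _ this]
  have "Above (quot_le P star one \<Theta>) ((\<lambda>i. \<Theta> `` {as i}) ` {1..n}) =
      {\<Theta> `` {x} | x. x \<in> Above le (as ` {1..n})}"
    by (auto simp: image_image)
  then show ?thesis
    using le_imp_quot_le quot_le_class_iff[OF assms(3,5)] partial_order_quot_le class_up_directed
    by blast
qed

end
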